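(* The graph $V_8$ has Gram dimension $4$, i.e., $\mathrm{gd}(V_8)=4$.
   Context: For a graph $G=([n],E)$, the Gram dimension $\mathrm{gd}(G)$ is the smallest integer $k\ge 1$ such that for every real symmetric positive semidefinite $n\times n$ matrix $X$ there exists a positive semidefinite $n\times n$ matrix $X'$ of rank at most $k$ with $X'_{ii}=X_{ii}$ for all $i\in[n]$ and $X'_{ij}=X_{ij}$ for all edges $ij\in E$. $V_8$ (the Wagner graph, or Möbius ladder on 8 nodes) is the graph on node set $\{1,\dots,8\}$ whose edges are those of the circuit $(1,2,\dots,8)$ together with the four chords $(1,5),(2,6),(3,7),(4,8)$. *)

theory Defs
  imports "HOL-Analysis.Analysis"
begin

text \<open>
  The node set \<open>[n]\<close> is rendered as an arbitrary finite type \<open>'n\<close>, and a graph on it is given by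
  its set of edges, each edge being a two-element set of nodes.
\<close>

definition psd :: "real ^ 'n ^ 'n \<Rightarrow> bool" where
  "psd A \<longleftrightarrow> transpose A = A \<and> (\<forall>x. 0 \<le> x \<bullet> (A *v x))"

definition gram_dim :: "'n::finite set set \<Rightarrow> nat" where
  "gram_dim E = (LEAST k. 1 \<le> k \<and>
     (\<forall>X :: real ^ 'n ^ 'n. psd X \<longrightarrow>
        (\<exists>X' :: real ^ 'n ^ 'n. psd X' \<and> rank X' \<le> k \<and>
           (\<forall>i. X' $ i $ i = X $ i $ i) \<and>
           (\<forall>i j. {i, j} \<in> E \<longrightarrow> X' $ i $ j = X $ i $ j))))"

text \<open>
  The nodes are the elements of the eight-element type \<open>8\<close>. Its arithmetic is modulo 8, so
  the node \<open>8\<close> is the same element as \<open>0\<close>.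
\<close>

definition V8 :: "8 set set" where
  "V8 = {{1, 2}, {2, 3}, {3, 4}, {4, 5}, {5, 6}, {6, 7}, {7, 8}, {8, 1}} \<union>
        {{1, 5}, {2, 6}, {3, 7}, {4, 8}}"

text \<open>
  Sanity checks: the minimum defining \<^const>\<open>gram_dim\<close> is taken over a nonempty set, and
  \<^const>\<open>V8\<close> is a simple graph with eight nodes and twelve edges.
\<close>

lemma gram_dim_set_nonempty:
  fixes E :: "'n::finite set set"
  shows "\<exists>k\<ge>1. \<forall>X :: real ^ 'n ^ 'n. psd X \<longrightarrow>
        (\<exists>X' :: real ^ 'n ^ 'n. psd X' \<and> rank X' \<le> k \<and>
           (\<forall>i. X' $ i $ i = X $ i $ i) \<and>
           (\<forall>i j. {i, j} \<in> E \<longrightarrow> X' $ i $ j = X $ i $ j))"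
proof (intro exI conjI allI impI)
  show "1 \<le> CARD('n)" by (simp add: Suc_leI)
  fix X :: "real ^ 'n ^ 'n"
  assume "psd X"
  then show "psd X" .
  show "rank X \<le> CARD('n)" using rank_bound[of X] by simp
qed simp_all

lemma V8_nodes: "(UNIV :: 8 set) = {1, 2, 3, 4, 5, 6, 7, 8}"
  and card_V8_nodes: "CARD(8) = 8"
proof -
  show "CARD(8) = 8" by simp
  have "card {1, 2, 3, 4, 5, 6, 7, 8 :: 8} = CARD(8)" by simp
  then show "(UNIV :: 8 set) = {1, 2, 3, 4, 5, 6, 7, 8}"
    by (metis card_subset_eq finite subset_UNIV)
qed

lemma V8_edges: "e \<in> V8 \<Longrightarrow> card e = 2"
  by (auto simp: V8_def)

lemma card_V8: "card V8 = 12"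
  by (simp add: V8_def doubleton_eq_iff)

end

theory Submission
  imports Defs
begin

text \<open>
  Upper bound: the nodes 1, 3, 6 are pairwise nonadjacent and have three neighbours each, so Gram
  vectors in four dimensions for \<open>S = {2, 4, 5, 7, 8}\<close> extend to all nodes as soon as the blocks
  \<open>{1, 2, 5, 8}\<close>, \<open>{3, 2, 7, 4}\<close> and \<open>{6, 2, 5, 7}\<close> are positive semidefinite. Hence it suffices to
  find a completion \<open>Z\<close> with these three blocks positive semidefinite and with a principal submatrix
  on \<open>S\<close> that is positive semidefinite and singular. Such a \<open>Z\<close> lies on the segment from the given
  \<open>X\<close> to any completion \<open>Y\<close> that satisfies the block conditions but is not positive definite
  on \<open>S\<close>.

  To find \<open>Y\<close>, increase the entry \<open>(2, 5)\<close> until one of the triangles \<open>{1, 2, 5}\<close>, \<open>{6, 2, 5}\<close> becomes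
  singular, and the entry \<open>(2, 7)\<close> until one of \<open>{3, 2, 7}\<close>, \<open>{6, 2, 7}\<close> does. If \<open>{1, 2, 5}\<close> is
  singular it has Gram vectors in a plane, in which a vector for node 8, constrained only by node 1,
  can be chosen too, so \<open>{2, 5, 8}\<close> is singular. Likewise, if \<open>{3, 2, 7}\<close> is singular then
  \<open>{2, 7, 4}\<close> can be made so. Otherwise 2, 5, 6, 7 have Gram vectors in a common plane and
  \<open>{2, 5, 7}\<close> is singular.

  Lower bound: contracting the edges 12, 34, 56, 78 gives the complete graph on four nodes, and the
  matrix with entry 1 inside these pairs and 0 elsewhere is its only completion.
\<close>

section \<open>Quadratic forms on finite index sets\<close>

definition qform :: "('a \<Rightarrow> 'a \<Rightarrow> real) \<Rightarrow> 'a set \<Rightarrow> ('a \<Rightarrow> real) \<Rightarrow> real" where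
  "qform K I v = (\<Sum>i\<in>I. \<Sum>j\<in>I. v i * v j * K i j)"

text \<open>The matrix stays a function on the whole type and only \<open>I\<close> varies, so
  passing to a principal submatrix needs no reindexing.\<close>

definition psd_on :: "('a \<Rightarrow> 'a \<Rightarrow> real) \<Rightarrow> 'a set \<Rightarrow> bool" where
  "psd_on K I \<longleftrightarrow> (\<forall>i\<in>I. \<forall>j\<in>I. K i j = K j i) \<and> (\<forall>v. 0 \<le> qform K I v)"

text \<open>Failure of positive definiteness on \<open>I\<close>. For a positive semidefinite
  \<open>K\<close> this is singularity, but \<open>\<le> 0\<close> also admits indefinite forms,
  which is all that the far end of a segment has to satisfy.\<close>

definition degenerate_on :: "('a \<Rightarrow> 'a \<Rightarrow> real) \<Rightarrow> 'a set \<Rightarrow> bool" where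
  "degenerate_on K I \<longleftrightarrow> (\<exists>v. (\<exists>i\<in>I. v i \<noteq> 0) \<and> qform K I v \<le> 0)"

definition gram_on :: "('a \<Rightarrow> 'a \<Rightarrow> real) \<Rightarrow> 'a set \<Rightarrow> ('a \<Rightarrow> 'e::euclidean_space) \<Rightarrow> bool" where
  "gram_on K I p \<longleftrightarrow> (\<forall>i\<in>I. \<forall>j\<in>I. p i \<bullet> p j = K i j)"

lemma gram_onD: "gram_on K I p \<Longrightarrow> i \<in> I \<Longrightarrow> j \<in> I \<Longrightarrow> p i \<bullet> p j = K i j"
  by (simp add: gram_on_def)

lemma qform_cong:
  assumes "\<And>i j. i \<in> I \<Longrightarrow> j \<in> I \<Longrightarrow> K i j = K' i j" and "\<And>i. i \<in> I \<Longrightarrow> v i = v' i"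
  shows "qform K I v = qform K' I v'"
  using assms by (auto simp: qform_def intro!: sum.cong)

lemma psd_on_cong:
  assumes "\<And>i j. i \<in> I \<Longrightarrow> j \<in> I \<Longrightarrow> K i j = K' i j"
  shows "psd_on K I \<longleftrightarrow> psd_on K' I"
proof -
  have "qform K I v = qform K' I v" for v
    by (rule qform_cong) (auto simp: assms)
  then show ?thesis by (auto simp: psd_on_def assms)
qed

lemma degenerate_on_cong:
  assumes "\<And>i j. i \<in> I \<Longrightarrow> j \<in> I \<Longrightarrow> K i j = K' i j"
  shows "degenerate_on K I \<longleftrightarrow> degenerate_on K' I"
proof -
  have "qform K I v = qform K' I v" for v
    by (rule qform_cong) (auto simp: assms)
  then show ?thesis by (simp add: degenerate_on_def)
qed

lemma qform_subset:
  assumes "finite I" "J \<subseteq> I"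
  shows "qform K I (\<lambda>i. if i \<in> J then v i else 0) = qform K J v"
proof -
  have "(\<Sum>j\<in>I. (if i \<in> J then v i else 0) * (if j \<in> J then v j else 0) * K i j)
      = (if i \<in> J then \<Sum>j\<in>J. v i * v j * K i j else 0)" for i
    using assms by (auto intro!: sum.mono_neutral_cong_right)
  then show ?thesis
    unfolding qform_def using assms by (auto intro!: sum.mono_neutral_cong_right)
qed

lemma psd_on_subset:
  assumes "psd_on K I" "finite I" "J \<subseteq> I"
  shows "psd_on K J"
proof -
  have "0 \<le> qform K J v" for v
    using assms(1) unfolding qform_subset[OF assms(2,3), of K v, symmetric] psd_on_def by blast
  then show ?thesis using assms(1,3) unfolding psd_on_def by blast
qed

lemma degenerate_on_superset:
  assumes "degenerate_on K J" "finite I" "J \<subseteq> I"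
  shows "degenerate_on K I"
proof -
  obtain v i where "i \<in> J" "v i \<noteq> 0" "qform K J v \<le> 0"
    using assms(1) unfolding degenerate_on_def by blast
  then show ?thesis
    using qform_subset[OF assms(2,3), of K v] assms(3) unfolding degenerate_on_def
    by (intro exI[of _ "\<lambda>i. if i \<in> J then v i else 0"]) auto
qed

lemma qform_affine:
  "qform (\<lambda>i j. s * A i j + t * B i j) I v = s * qform A I v + t * qform B I v"
  by (simp add: qform_def sum_distrib_left distrib_left sum.distrib ac_simps)

lemma qform_scale: "qform K I (\<lambda>i. c * v i) = c\<^sup>2 * qform K I v"
  by (simp add: qform_def sum_distrib_left power2_eq_square ac_simps)

lemma psd_on_convex:
  assumes "psd_on A I" "psd_on B I" "0 \<le> t" "t \<le> 1"
  shows "psd_on (\<lambda>i j. (1 - t) * A i j + t * B i j) I"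
  using assms unfolding psd_on_def qform_affine by simp

text \<open>Close to \<open>t = 0\<close> the linear term dominates, so a nonzero \<open>s\<close>
  would give a negative value at a small \<open>t\<close> of the opposite sign.\<close>

lemma quadratic_nonneg_imp_linear_zero:
  fixes s c :: real
  assumes "\<And>t. 0 \<le> 2 * t * s + t\<^sup>2 * c"
  shows "s = 0"
proof (rule ccontr)
  assume "s \<noteq> 0"
  \<comment> \<open>A positive number above \<open>c\<close>, whatever the sign of \<open>c\<close>;
    the test point is \<open>- s / d\<close>.\<close>
  define d where "d = \<bar>c\<bar> + 1"
  have d: "d > 0" "c < d" by (auto simp: d_def)
  have "2 * (- s / d) * s + (- s / d)\<^sup>2 * c = (s\<^sup>2 / d\<^sup>2) * (c - 2 * d)"
    using d by (simp add: power2_eq_square field_simps)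
  moreover have "\<dots> < 0"
    using d \<open>s \<noteq> 0\<close> by (intro mult_pos_neg) auto
  ultimately show False using assms[of "- s / d"] by linarith
qed

text \<open>Such a \<open>v\<close> minimises the form, so the gradient vanishes there and
  \<open>v\<close> lies in the kernel. Perturbing \<open>v\<close> along the unit vector at
  \<open>i\<close> gives the inequality of \<open>quadratic_nonneg_imp_linear_zero\<close>.\<close>

lemma psd_on_null:
  assumes "finite I" "psd_on K I" "qform K I v \<le> 0" "i \<in> I"
  shows "(\<Sum>j\<in>I. K i j * v j) = 0"
proof (rule quadratic_nonneg_imp_linear_zero)
  fix t :: real
  define w where "w = (\<lambda>k. if k = i then 1 else 0 :: real)"
  have sym: "K k l = K l k" if "k \<in> I" "l \<in> I" for k l
    using assms(2) that unfolding psd_on_def by blast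
  have w: "(\<Sum>l\<in>I. w l * f l) = f i" for f :: "'a \<Rightarrow> real"
    using assms(1,4) by (simp add: w_def if_distrib[of "\<lambda>x. x * _"] cong: if_cong)
  have "qform K I (\<lambda>k. v k + t * w k)
     = (\<Sum>k\<in>I. \<Sum>l\<in>I. v k * v l * K k l) + t * (\<Sum>k\<in>I. \<Sum>l\<in>I. w l * (v k * K k l))
       + t * (\<Sum>k\<in>I. w k * (\<Sum>l\<in>I. v l * K k l)) + t\<^sup>2 * (\<Sum>k\<in>I. w k * (\<Sum>l\<in>I. w l * K k l))"
    unfolding qform_def
    by (simp add: algebra_simps sum.distrib sum_distrib_left power2_eq_square)
  also have "(\<Sum>k\<in>I. \<Sum>l\<in>I. w l * (v k * K k l)) = (\<Sum>j\<in>I. K i j * v j)"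
    unfolding w using sym assms(4) by (auto intro!: sum.cong)
  also have "(\<Sum>k\<in>I. w k * (\<Sum>l\<in>I. v l * K k l)) = (\<Sum>j\<in>I. K i j * v j)"
    unfolding w by (auto intro!: sum.cong)
  finally have "qform K I (\<lambda>k. v k + t * w k)
      = qform K I v + 2 * t * (\<Sum>j\<in>I. K i j * v j) + t\<^sup>2 * K i i"
    unfolding w by (simp add: qform_def)
  moreover have "0 \<le> qform K I (\<lambda>k. v k + t * w k)"
    using assms(2) by (auto simp: psd_on_def)
  ultimately show "0 \<le> 2 * t * (\<Sum>j\<in>I. K i j * v j) + t\<^sup>2 * K i i"
    using assms(3) by linarith
qed

lemma qform_insert:
  assumes "finite I" "j \<notin> I" "\<And>i. i \<in> I \<Longrightarrow> K i j = K j i"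
  shows "qform K (insert j I) v
    = qform K I v + 2 * v j * (\<Sum>i\<in>I. K j i * v i) + (v j)\<^sup>2 * K j j"
proof -
  have "(\<Sum>i\<in>I. v i * v j * K i j) = v j * (\<Sum>i\<in>I. K j i * v i)"
    "(\<Sum>i\<in>I. v j * v i * K j i) = v j * (\<Sum>i\<in>I. K j i * v i)"
    using assms(3) by (auto simp: sum_distrib_left intro!: sum.cong)
  then show ?thesis
    using assms(1,2) by (simp add: qform_def sum.distrib power2_eq_square)
qed

section \<open>Gram vectors and their extension to a new node\<close>

lemma gram_on_norm:
  assumes "gram_on K I p"
  shows "(\<Sum>i\<in>I. v i *\<^sub>R p i) \<bullet> (\<Sum>i\<in>I. v i *\<^sub>R p i) = qform K I v"
  unfolding qform_def inner_sum_left unfolding inner_sum_right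
  using assms by (auto simp: gram_on_def intro!: sum.cong)

lemma gram_on_psd: "gram_on K I p \<Longrightarrow> psd_on K I"
  unfolding psd_on_def
  by (simp add: gram_on_norm[symmetric]) (simp add: gram_on_def, metis inner_commute)

lemma gram_on_subset: "gram_on K I p \<Longrightarrow> J \<subseteq> I \<Longrightarrow> gram_on K J p"
  by (auto simp: gram_on_def)

text \<open>More vectors than dimensions are linearly dependent, and by \<open>gram_on_norm\<close>
  the coefficients of a dependence are a null vector of the form.\<close>

lemma gram_on_degenerate:
  fixes p :: "'a \<Rightarrow> 'e::euclidean_space"
  assumes "gram_on K I p" "finite I" "DIM('e) < card I"
  shows "degenerate_on K I"
proof -
  have "\<exists>v. (\<exists>i\<in>I. v i \<noteq> 0) \<and> (\<Sum>i\<in>I. v i *\<^sub>R p i) = 0"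
  proof (cases "inj_on p I")
    case True
    then have "dependent (p ` I)"
      using assms(3) by (intro dependent_biggerset) (simp add: card_image)
    then obtain u where u: "\<exists>x\<in>p ` I. u x \<noteq> 0" "(\<Sum>x\<in>p ` I. u x *\<^sub>R x) = 0"
      using dependent_finite[of "p ` I"] assms(2) by auto
    then show ?thesis
      using True by (intro exI[of _ "u \<circ> p"]) (auto simp: sum.reindex)
  next
    case False
    then obtain i j where ij: "i \<in> I" "j \<in> I" "i \<noteq> j" "p i = p j"
      by (auto simp: inj_on_def)
    have "(\<Sum>k\<in>I. ((if k = i then 1 else 0) - (if k = j then 1 else 0)) *\<^sub>R p k)
        = (\<Sum>k\<in>I. if k = i then p k else 0) - (\<Sum>k\<in>I. if k = j then p k else 0)"
      unfolding sum_subtractf[symmetric] by (intro sum.cong) (auto simp: algebra_simps)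
    also have "\<dots> = 0" using ij assms(2) by simp
    finally show ?thesis using ij
      by (intro exI[of _ "\<lambda>k. (if k = i then 1 else 0) - (if k = j then 1 else 0)"]) auto
  qed
  then obtain v where "\<exists>i\<in>I. v i \<noteq> 0" "(\<Sum>i\<in>I. v i *\<^sub>R p i) = 0" by blast
  then show ?thesis
    unfolding degenerate_on_def using gram_on_norm[OF assms(1), of v]
    by (intro exI[of _ v]) simp
qed

text \<open>The column of \<open>j\<close> lies in the range of the block on \<open>I\<close>: a
  vector orthogonal to that range is null for the block, and semidefiniteness on the larger set
  makes it orthogonal to the column too.\<close>

lemma gram_equations_solvable:
  fixes K :: "'a::finite \<Rightarrow> 'a \<Rightarrow> real"
  assumes psd: "psd_on K (insert j I)" and j: "j \<notin> I"
  shows "\<exists>c. \<forall>k\<in>I. (\<Sum>i\<in>I. K k i * c i) = K k j"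
proof -
  have sym: "K k j = K j k" if "k \<in> I" for k
    using psd that unfolding psd_on_def by blast
  define G where "G = (\<lambda>c :: real^'a. (\<chi> k. if k \<in> I then \<Sum>i\<in>I. K k i * c $ i else 0) :: real^'a)"
  define b where "b = ((\<chi> k. if k \<in> I then K k j else 0) :: real^'a)"
  have "linear G"
    by (rule linearI)
      (auto simp: G_def vec_eq_iff sum.distrib algebra_simps sum_distrib_left)
  then have sub: "subspace (range G)"
    using linear_subspace_image subspace_UNIV by blast
  \<comment> \<open>Splits the column \<open>b\<close> into a part in the range and an orthogonal
    remainder \<open>z\<close>; the aim is \<open>z = 0\<close>.\<close>
  obtain w z where w: "w \<in> span (range G)" and z: "\<And>y. y \<in> span (range G) \<Longrightarrow> orthogonal z y"
    and bwz: "b = w + z"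
    using orthogonal_subspace_decomp_exists[of "range G" b] by blast
  have zI: "(\<Sum>k\<in>I. z $ k * y $ k) = z \<bullet> y" if "\<And>k. k \<notin> I \<Longrightarrow> y $ k = 0" for y
    unfolding inner_vec_def using that by (auto intro!: sum.mono_neutral_left)
  have "z \<bullet> G z = 0"
    using z[of "G z"] by (auto simp: orthogonal_def span_base)
  moreover have "z \<bullet> G z = (\<Sum>k\<in>I. z $ k * G z $ k)"
    by (rule zI[symmetric]) (simp add: G_def)
  moreover have "\<dots> = qform K I (($) z)"
    unfolding qform_def
    by (intro sum.cong refl) (simp add: G_def sum_distrib_left ac_simps)
  ultimately have q: "qform K I (($) z) = 0" by simp
  \<comment> \<open>Extended by 0 at \<open>j\<close>, \<open>z\<close> is still null for the form,
    so \<open>psd_on_null\<close> at row \<open>j\<close> yields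
    \<open>z \<bullet> b = 0\<close>.\<close>
  define v where "v = (\<lambda>i. if i = j then 0 else z $ i)"
  have vI: "v i = z $ i" if "i \<in> I" for i using j that by (auto simp: v_def)
  have "qform K (insert j I) v
      = qform K I v + 2 * v j * (\<Sum>i\<in>I. K j i * v i) + (v j)\<^sup>2 * K j j"
    by (intro qform_insert j sym) auto
  then have "qform K (insert j I) v = qform K I v"
    by (simp add: v_def)
  also have "\<dots> = 0" using q qform_cong[of I K K v "($) z"] vI by auto
  finally have "(\<Sum>i\<in>insert j I. K j i * v i) = 0"
    by (intro psd_on_null[OF _ psd]) auto
  then have "(\<Sum>i\<in>I. K j i * z $ i) = 0"
    using j vI by (simp add: v_def cong: sum.cong)
  moreover have "z \<bullet> b = (\<Sum>k\<in>I. z $ k * b $ k)"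
    by (rule zI[symmetric]) (simp add: b_def)
  moreover have "\<dots> = (\<Sum>i\<in>I. K j i * z $ i)"
    using sym by (intro sum.cong refl) (simp add: b_def)
  ultimately have "z \<bullet> b = 0" by simp
  moreover have "z \<bullet> w = 0" using z[OF w] by (simp add: orthogonal_def)
  ultimately have "z = 0" using bwz by (simp add: inner_add_right)
  then have "b \<in> range G" using w bwz sub by (metis add.right_neutral span_eq_iff)
  then obtain c where "b = G c" by blast
  then have eq: "G c $ k = b $ k" for k by simp
  have "(\<Sum>i\<in>I. K k i * c $ i) = K k j" if "k \<in> I" for k
    using eq[of k] that by (simp add: b_def G_def)
  then show ?thesis by blast
qed

text \<open>A combination \<open>u\<close> of the old vectors already has the required inner
  products with them. The missing squared length is a Schur complement, hence nonnegative, and is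
  added along a unit vector \<open>e\<close> orthogonal to the old ones; this needs one spare
  dimension.\<close>

lemma gram_on_extend:
  fixes K :: "'a::finite \<Rightarrow> 'a \<Rightarrow> real" and p :: "'a \<Rightarrow> 'e::euclidean_space"
  assumes psd: "psd_on K (insert j I)" and j: "j \<notin> I" and p: "gram_on K I p"
    and dim: "dim (p ` I) < DIM('e)"
  shows "\<exists>x. gram_on K (insert j I) (p(j := x))"
proof -
  have sym: "K k l = K l k" if "k \<in> insert j I" "l \<in> insert j I" for k l
    using psd that unfolding psd_on_def by blast
  obtain c where c: "\<And>k. k \<in> I \<Longrightarrow> (\<Sum>i\<in>I. K k i * c i) = K k j"
    using gram_equations_solvable[OF psd j] by blast
  obtain e0 where e0: "e0 \<noteq> 0" "\<And>y. y \<in> span (p ` I) \<Longrightarrow> orthogonal e0 y"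
    using orthogonal_to_subspace_exists[OF dim] by blast
  define e where "e = e0 /\<^sub>R norm e0"
  have ep: "e \<bullet> p k = 0" if "k \<in> I" for k
    using e0(2)[of "p k"] that by (simp add: e_def orthogonal_def span_base)
  have ee: "e \<bullet> e = 1"
    using e0(1) by (simp add: e_def dot_square_norm power2_eq_square)
  define u where "u = (\<Sum>i\<in>I. c i *\<^sub>R p i)"
  have up: "u \<bullet> p k = K k j" if "k \<in> I" for k
    unfolding u_def inner_sum_left c[OF that, symmetric]
    using p that by (auto simp: gram_on_def sym intro!: sum.cong)
  have ue: "u \<bullet> e = 0"
    unfolding u_def inner_sum_left by (auto simp: ep inner_commute intro!: sum.neutral)
  have uu: "u \<bullet> u = (\<Sum>i\<in>I. K j i * c i)"
    by (subst (2) u_def, unfold inner_sum_right) (auto simp: up sym ac_simps intro!: sum.cong)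
  \<comment> \<open>With the entry -1 at \<open>j\<close>, the form takes the Schur complement
    \<open>K j j - u \<bullet> u\<close> as its value.\<close>
  define v where "v = c(j := -1)"
  have vI: "(\<Sum>i\<in>I. K j i * v i) = u \<bullet> u"
    unfolding uu v_def using j by (auto intro!: sum.cong)
  have "qform K I v = u \<bullet> u"
    unfolding u_def gram_on_norm[OF p] using j by (auto simp: v_def intro!: qform_cong)
  moreover have "v j = -1" by (simp add: v_def)
  moreover have "qform K (insert j I) v
      = qform K I v + 2 * v j * (\<Sum>i\<in>I. K j i * v i) + (v j)\<^sup>2 * K j j"
    by (rule qform_insert[OF _ j]) (auto intro: sym)
  ultimately have "qform K (insert j I) v = K j j - u \<bullet> u"
    by (simp add: vI)
  then have le: "0 \<le> K j j - u \<bullet> u"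
    using psd unfolding psd_on_def by metis
  define x where "x = u + sqrt (K j j - u \<bullet> u) *\<^sub>R e"
  have "x \<bullet> x = K j j"
    using le by (simp add: x_def inner_add_left inner_add_right ue ee inner_commute[of e u])
  moreover have "x \<bullet> p k = K k j" if "k \<in> I" for k
    using that by (simp add: x_def inner_add_left up ep)
  ultimately have "gram_on K (insert j I) (p(j := x))"
    using p j sym unfolding gram_on_def by (auto simp: inner_commute)
  then show ?thesis by blast
qed

text \<open>Nodes are added one by one; before each step the vectors span at most
  \<open>card I\<close> dimensions, which leaves one spare.\<close>

lemma gram_on_exists:
  fixes K :: "'a::finite \<Rightarrow> 'a \<Rightarrow> real"
  assumes "psd_on K I" "card I \<le> DIM('e::euclidean_space)"
  shows "\<exists>p :: 'a \<Rightarrow> 'e. gram_on K I p"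
proof -
  have "finite I" by simp
  then show ?thesis using assms
  proof (induction I rule: finite_induct)
    case empty
    then show ?case by (simp add: gram_on_def)
  next
    case (insert j I)
    have "psd_on K I" using psd_on_subset[OF insert.prems(1)] by auto
    then obtain p :: "'a \<Rightarrow> 'e" where p: "gram_on K I p"
      using insert by auto
    have "dim (p ` I) \<le> card (p ` I)" by (rule dim_le_card') simp
    also have "\<dots> \<le> card I" by (rule card_image_le) simp
    also have "\<dots> < DIM('e)" using insert by simp
    finally show ?case
      using gram_on_extend[OF insert.prems(1) insert.hyps(2) p] by blast
  qed
qed

text \<open>Degeneracy replaces the spare dimension. If a null vector is nonzero at
  \<open>j\<close>, the new vector is a combination of the old ones; otherwise the old ones are
  dependent and leave a dimension free for \<open>gram_on_extend\<close>.\<close>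

lemma gram_on_extend_degenerate:
  fixes K :: "'a::finite \<Rightarrow> 'a \<Rightarrow> real" and p :: "'a \<Rightarrow> 'e::euclidean_space"
  assumes psd: "psd_on K (insert j I)" and deg: "degenerate_on K (insert j I)"
    and j: "j \<notin> I" and p: "gram_on K I p" and card: "card I \<le> DIM('e)"
  shows "\<exists>x. gram_on K (insert j I) (p(j := x))"
proof -
  have sym: "K k l = K l k" if "k \<in> insert j I" "l \<in> insert j I" for k l
    using psd that unfolding psd_on_def by blast
  obtain v i where v: "qform K (insert j I) v \<le> 0" and i: "i \<in> insert j I" "v i \<noteq> 0"
    using deg by (auto simp: degenerate_on_def)
  have null: "(\<Sum>l\<in>I. K k l * v l) + K k j * v j = 0" if "k \<in> insert j I" for k
    using psd_on_null[OF _ psd v that] j by simp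
  show ?thesis
  proof (cases "v j = 0")
    case True
    then have iI: "i \<in> I" using i by auto
    have "qform K (insert j I) v
        = qform K I v + 2 * v j * (\<Sum>i\<in>I. K j i * v i) + (v j)\<^sup>2 * K j j"
      by (rule qform_insert[OF _ j]) (auto intro: sym)
    then have "qform K I v \<le> 0"
      using v True by simp
    then have "(\<Sum>k\<in>I. v k *\<^sub>R p k) = 0"
      using gram_on_norm[OF p, of v] by (metis antisym inner_eq_zero_iff inner_ge_zero)
    then have "v i *\<^sub>R p i + (\<Sum>k\<in>I - {i}. v k *\<^sub>R p k) = 0"
      using iI by (simp add: sum.remove[of I i])
    then have "v i *\<^sub>R p i = - (\<Sum>k\<in>I - {i}. v k *\<^sub>R p k)"
      by (simp add: eq_neg_iff_add_eq_0)
    also have "\<dots> \<in> span (p ` (I - {i}))"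
      by (intro span_neg span_sum span_scale span_base) auto
    finally have "p i \<in> span (p ` (I - {i}))"
      using i(2) span_scale[of "v i *\<^sub>R p i" "p ` (I - {i})" "1 / v i"] by simp
    then have "span (insert (p i) (p ` (I - {i}))) = span (p ` (I - {i}))"
      by (rule span_redundant)
    moreover have "insert (p i) (p ` (I - {i})) = p ` I" using iI by auto
    ultimately have "dim (p ` I) = dim (p ` (I - {i}))" by (metis dim_span)
    also have "\<dots> \<le> card (p ` (I - {i}))" by (rule dim_le_card') simp
    also have "\<dots> \<le> card (I - {i})" by (rule card_image_le) simp
    also have "\<dots> < card I" using iI by (intro psubset_card_mono) auto
    finally show ?thesis
      using card by (intro gram_on_extend[OF psd j p]) linarith
  next
    case False
    \<comment> \<open>The dependence with coefficients \<open>v\<close>, solved for the vector at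
      \<open>j\<close>.\<close>
    define x where "x = (- 1 / v j) *\<^sub>R (\<Sum>k\<in>I. v k *\<^sub>R p k)"
    have xp: "x \<bullet> p k = K k j" if "k \<in> I" for k
    proof -
      have "(\<Sum>l\<in>I. v l *\<^sub>R p l) \<bullet> p k = (\<Sum>l\<in>I. K k l * v l)"
        unfolding inner_sum_left using p that by (auto simp: gram_on_def sym intro!: sum.cong)
      then show ?thesis
        using null[of k] that False by (simp add: x_def field_simps)
    qed
    have "x \<bullet> (\<Sum>l\<in>I. v l *\<^sub>R p l) = (\<Sum>l\<in>I. K j l * v l)"
      unfolding inner_sum_right by (auto simp: xp sym intro!: sum.cong)
    then have "x \<bullet> x = K j j"
      using null[of j] False by (subst (2) x_def) (simp add: field_simps)
    then have "gram_on K (insert j I) (p(j := x))"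
      using p j sym xp unfolding gram_on_def by (auto simp: inner_commute)
    then show ?thesis by blast
  qed
qed

section \<open>Degenerate points on segments of matrices\<close>

text \<open>If \<open>A\<close> is positive definite, let \<open>m\<close> be the maximum of
  \<open>- B / A\<close> over unit vectors. Then \<open>m * A + B\<close> is positive semidefinite
  and vanishes at a maximiser, and rescaling puts it on the segment.\<close>

lemma psd_segment_hits_degenerate:
  fixes A B :: "'a::finite \<Rightarrow> 'a \<Rightarrow> real"
  assumes A: "psd_on A I" and B: "degenerate_on B I"
    and sym: "\<And>i j. i \<in> I \<Longrightarrow> j \<in> I \<Longrightarrow> B i j = B j i"
  shows "\<exists>t. 0 \<le> t \<and> t \<le> 1 \<and> psd_on (\<lambda>i j. (1 - t) * A i j + t * B i j) I
    \<and> degenerate_on (\<lambda>i j. (1 - t) * A i j + t * B i j) I"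
proof (cases "degenerate_on A I")
  case True
  then show ?thesis using A by (intro exI[of _ 0]) simp
next
  case False
  then have pos: "0 < qform A I v" if "i \<in> I" "v i \<noteq> 0" for v i
    using that unfolding degenerate_on_def by (meson not_le)
  \<comment> \<open>Unit vectors supported on \<open>I\<close>: a compact set on which the form of
    \<open>A\<close> is positive.\<close>
  define S where "S = {x :: real^'a. norm x = 1 \<and> (\<forall>i. i \<notin> I \<longrightarrow> x $ i = 0)}"
  have "S = sphere 0 1 \<inter> {x :: real^'a. \<forall>i. i \<notin> I \<longrightarrow> x $ i = 0}"
    by (auto simp: S_def)
  moreover have "closed {x :: real^'a. \<forall>i. i \<notin> I \<longrightarrow> x $ i = 0}"
    by (intro closed_Collect_all closed_Collect_imp open_Collect_const closed_Collect_eq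
        continuous_intros)
  ultimately have "compact S" by (simp add: compact_Int_closed)
  have posS: "0 < qform A I (($) x)" if "x \<in> S" for x
  proof -
    have "x \<noteq> 0" using that by (auto simp: S_def)
    then obtain i where "x $ i \<noteq> 0" by (auto simp: vec_eq_iff)
    then show ?thesis using that pos[of i] by (auto simp: S_def)
  qed
  \<comment> \<open>The factor does not depend on \<open>K\<close>, so signs found on
    \<open>S\<close> carry over for several matrices at once.\<close>
  have normalize: "\<exists>x\<in>S. \<exists>c. \<forall>K. qform K I v = c\<^sup>2 * qform K I (($) x)"
    if "i \<in> I" "v i \<noteq> 0" for v i
  proof -
    define y where "y = ((\<chi> i. if i \<in> I then v i else 0) :: real^'a)"
    have "y $ i \<noteq> 0" using that by (simp add: y_def)
    then have y0: "y \<noteq> 0" by auto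
    define x where "x = y /\<^sub>R norm y"
    have "x \<in> S" using y0 by (simp add: S_def x_def) (simp add: y_def)
    moreover have "qform K I v = (norm y)\<^sup>2 * qform K I (($) x)" for K
      unfolding qform_scale[symmetric] using y0
      by (intro qform_cong) (simp_all add: x_def, simp add: y_def)
    ultimately show ?thesis by blast
  qed
  have cont: "continuous_on S (\<lambda>x. qform K I (($) x))" for K
    unfolding qform_def by (intro continuous_intros)
  obtain w i0 where w: "i0 \<in> I" "w i0 \<noteq> 0" "qform B I w \<le> 0"
    using B unfolding degenerate_on_def by blast
  obtain x1 c where x1: "x1 \<in> S" and c: "\<And>K. qform K I w = c\<^sup>2 * qform K I (($) x1)"
    using normalize[of i0 w] w by blast
  have "0 < c\<^sup>2 * qform A I (($) x1)" using pos[of i0 w] w c by metis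
  then have "c \<noteq> 0" by auto
  then have Bx1: "qform B I (($) x1) \<le> 0"
    using w(3) unfolding c[of B] by (simp add: mult_le_0_iff not_le)
  define f where "f = (\<lambda>x :: real^'a. - qform B I (($) x) / qform A I (($) x))"
  have "continuous_on S f"
    unfolding f_def using posS by (intro continuous_intros cont) force
  then obtain x0 where x0: "x0 \<in> S" and max: "\<And>x. x \<in> S \<Longrightarrow> f x \<le> f x0"
    using continuous_attains_sup[OF \<open>compact S\<close>] x1 by blast
  define m where "m = f x0"
  \<comment> \<open>This is where degeneracy of \<open>B\<close> enters: \<open>m\<close> is
    nonnegative, so \<open>t\<close> lies between 0 and 1.\<close>
  have "0 \<le> f x1" using Bx1 posS[OF x1] by (simp add: f_def divide_nonpos_pos)
  then have m: "0 \<le> m" using max[OF x1] by (simp add: m_def)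
  \<comment> \<open>Chosen so that \<open>1 - t = t * m\<close>, which makes \<open>Z\<close> equal
    to \<open>t\<close> times \<open>m * A + B\<close>.\<close>
  define t where "t = 1 / (1 + m)"
  have t: "0 < t" "t \<le> 1" "1 - t = t * m" using m by (auto simp: t_def field_simps)
  define Z where "Z = (\<lambda>i j. (1 - t) * A i j + t * B i j)"
  have Z: "qform Z I v = t * (m * qform A I v + qform B I v)" for v
    unfolding Z_def qform_affine t(3) by (simp add: algebra_simps)
  have "0 \<le> qform Z I v" for v
  proof (cases "\<exists>i\<in>I. v i \<noteq> 0")
    case True
    then obtain x c where x: "x \<in> S" and c: "\<And>K. qform K I v = c\<^sup>2 * qform K I (($) x)"
      using normalize by metis
    have "0 \<le> m * qform A I (($) x) + qform B I (($) x)"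
      using max[OF x] posS[OF x] unfolding m_def[symmetric] by (simp add: f_def field_simps)
    then have "0 \<le> qform Z I (($) x)" unfolding Z using t by simp
    then show ?thesis unfolding c[of Z] by simp
  next
    case False
    then show ?thesis by (simp add: qform_def)
  qed
  moreover have "Z i j = Z j i" if "i \<in> I" "j \<in> I" for i j
  proof -
    have "A i j = A j i" using A that unfolding psd_on_def by blast
    then show ?thesis using sym[OF that] by (simp add: Z_def)
  qed
  ultimately have "psd_on Z I" unfolding psd_on_def by blast
  moreover have "degenerate_on Z I"
  proof -
    have "qform Z I (($) x0) = 0"
      unfolding Z using posS[OF x0] by (simp add: m_def f_def)
    moreover have "x0 \<noteq> 0" using x0 by (auto simp: S_def)
    then obtain i where "x0 $ i \<noteq> 0" by (auto simp: vec_eq_iff)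
    ultimately show ?thesis
      using x0 unfolding degenerate_on_def S_def by (intro exI[of _ "($) x0"]) auto
  qed
  ultimately show ?thesis using t unfolding Z_def by (intro exI[of _ t]) auto
qed

section \<open>Stretching one entry and completing four-node blocks\<close>

definition set_entry :: "('a \<Rightarrow> 'a \<Rightarrow> real) \<Rightarrow> 'a \<Rightarrow> 'a \<Rightarrow> real \<Rightarrow> 'a \<Rightarrow> 'a \<Rightarrow> real" where
  "set_entry K b c y = (\<lambda>i j. if (i = b \<and> j = c) \<or> (i = c \<and> j = b) then y else K i j)"

lemma set_entry_affine:
  "set_entry K b c ((1 - t) * y + t * z)
    = (\<lambda>i j. (1 - t) * set_entry K b c y i j + t * set_entry K b c z i j)"
  by (auto simp: set_entry_def fun_eq_iff algebra_simps)

text \<open>Moving the entry towards \<open>y1\<close> makes each block degenerate at some time. At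
  the earlier of the two times the other block is still positive semidefinite, by convexity.\<close>

lemma stretch_entry:
  fixes K :: "'a::finite \<Rightarrow> 'a \<Rightarrow> real"
  assumes K: "psd_on K I" "psd_on K J" and bc: "b \<in> I" "c \<in> I" "b \<in> J" "c \<in> J" "b \<noteq> c"
  shows "\<exists>y. psd_on (set_entry K b c y) I \<and> psd_on (set_entry K b c y) J
    \<and> (degenerate_on (set_entry K b c y) I \<or> degenerate_on (set_entry K b c y) J)"
proof -
  define y0 where "y0 = K b c"
  \<comment> \<open>With this entry the form vanishes at the vector with 1 at \<open>b\<close> and
    -1 at \<open>c\<close>, so both blocks are degenerate.\<close>
  define y1 where "y1 = (K b b + K c c) / 2"
  define Z where "Z = (\<lambda>t. set_entry K b c ((1 - t) * y0 + t * y1))"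
  have sym: "K i j = K j i" if "i \<in> I \<and> j \<in> I \<or> i \<in> J \<and> j \<in> J" for i j
    using K that unfolding psd_on_def by blast
  have "K c b = K b c" using bc by (intro sym) auto
  then have e0: "set_entry K b c y0 = K"
    by (auto simp: set_entry_def y0_def fun_eq_iff)
  have Z: "Z t = (\<lambda>i j. (1 - t) * K i j + t * set_entry K b c y1 i j)" for t
    unfolding Z_def set_entry_affine e0 ..
  have hit: "\<exists>t. 0 \<le> t \<and> t \<le> 1 \<and> psd_on (Z t) L \<and> degenerate_on (Z t) L"
    if L: "L = I \<or> L = J" for L
    unfolding Z
  proof (rule psd_segment_hits_degenerate)
    show "psd_on K L" using L K by auto
    show "set_entry K b c y1 i j = set_entry K b c y1 j i" if "i \<in> L" "j \<in> L" for i j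
      using sym[of i j] that L by (auto simp: set_entry_def)
    have "qform (set_entry K b c y1) {b, c} (\<lambda>i. if i = b then 1 else -1) = 0"
      using bc(5) by (simp add: qform_def set_entry_def y1_def field_simps)
    then have "degenerate_on (set_entry K b c y1) {b, c}"
      unfolding degenerate_on_def by (intro exI[of _ "\<lambda>i. if i = b then 1 else -1"]) auto
    then show "degenerate_on (set_entry K b c y1) L"
      using L bc by (intro degenerate_on_superset[of _ "{b, c}" L]) auto
  qed
  obtain s where s: "0 \<le> s" "s \<le> 1" "psd_on (Z s) I" "degenerate_on (Z s) I"
    using hit by blast
  obtain t where t: "0 \<le> t" "t \<le> 1" "psd_on (Z t) J" "degenerate_on (Z t) J"
    using hit by blast
  \<comment> \<open>\<open>Z s\<close> is a convex combination of \<open>K\<close> and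
    \<open>Z t\<close> with weight \<open>s / t\<close>.\<close>
  have shrink: "psd_on (Z s) L" if "0 \<le> s" "s \<le> t" "psd_on K L" "psd_on (Z t) L" for s t L
  proof (cases "t = 0")
    case True
    then show ?thesis using that by simp
  next
    case False
    have "psd_on (\<lambda>i j. (1 - s / t) * K i j + s / t * Z t i j) L"
      using that False by (intro psd_on_convex) auto
    moreover have "(\<lambda>i j. (1 - s / t) * K i j + s / t * Z t i j) = Z s"
      using False by (simp add: Z fun_eq_iff field_simps)
    ultimately show ?thesis by simp
  qed
  show ?thesis
  proof (cases "s \<le> t")
    case True
    then have "psd_on (Z s) J" using shrink s t K by blast
    then show ?thesis using s unfolding Z_def by blast
  next
    case False
    then have "psd_on (Z t) I" using shrink[of t s I] s t K by auto
    then show ?thesis using t unfolding Z_def by blast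
  qed
qed

text \<open>Only its product with the vector of \<open>a\<close> constrains the vector of
  \<open>d\<close>, so any space of dimension at least 2 has room for it. A degenerate triangle fits
  in a plane, and then the vectors of \<open>b\<close>, \<open>c\<close>, \<open>d\<close> are three
  in a plane.\<close>

lemma psd_add_leaf:
  fixes K :: "'a::finite \<Rightarrow> 'a \<Rightarrow> real"
  assumes abc: "psd_on K {a, b, c}" and ad: "psd_on K {a, d}" and dist: "distinct [a, b, c, d]"
  shows "\<exists>K'. psd_on K' {a, b, c, d} \<and> (\<forall>i\<in>{a, b, c}. \<forall>j\<in>{a, b, c}. K' i j = K i j)
    \<and> (\<forall>i\<in>{a, d}. \<forall>j\<in>{a, d}. K' i j = K i j)
    \<and> (degenerate_on K {a, b, c} \<longrightarrow> degenerate_on K' {b, c, d})"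
proof -
  have ext: "\<exists>x. gram_on K {a, b, c} (p(d := x)) \<and> gram_on K {a, d} (p(d := x))"
    if p: "gram_on K {a, b, c} p" and "1 < DIM('e)" for p :: "'a \<Rightarrow> 'e::euclidean_space"
  proof -
    have "dim (p ` {a}) \<le> 1" using dim_le_card'[of "p ` {a}"] by simp
    then have "dim (p ` {a}) < DIM('e)" using that(2) by linarith
    moreover have "psd_on K (insert d {a})" using ad by (simp add: insert_commute)
    ultimately obtain x where "gram_on K (insert d {a}) (p(d := x))"
      using gram_on_extend[of K d "{a}" p] gram_on_subset[OF p, of "{a}"] dist by auto
    then show ?thesis
      using p dist by (intro exI[of _ x]) (auto simp: gram_on_def)
  qed
  have res: "gram_on (\<lambda>i j. q i \<bullet> q j) L q" for q :: "'a \<Rightarrow> 'e::euclidean_space" and L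
    by (simp add: gram_on_def)
  show ?thesis
  proof (cases "degenerate_on K {a, b, c}")
    case False
    \<comment> \<open>Four dimensions are merely ample: three for the triangle and more than one for
      the leaf.\<close>
    obtain p :: "'a \<Rightarrow> real^4" where "gram_on K {a, b, c} p"
      using gram_on_exists[OF abc, where 'e="real^4"] dist by auto
    then obtain q :: "'a \<Rightarrow> real^4" where "gram_on K {a, b, c} q" "gram_on K {a, d} q"
      using ext[of p] by auto
    then show ?thesis
      using False gram_on_psd[OF res]
      by (intro exI[of _ "\<lambda>i j. q i \<bullet> q j"]) (auto simp: gram_on_def)
  next
    case True
    have "psd_on K {a, b}" using psd_on_subset[OF abc] by auto
    then obtain p :: "'a \<Rightarrow> real^2" where p: "gram_on K {a, b} p"
      using gram_on_exists[of K "{a, b}", where 'e="real^2"] dist by auto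
    have "insert c {a, b} = {a, b, c}" by auto
    then obtain x where "gram_on K {a, b, c} (p(c := x))"
      using gram_on_extend_degenerate[of K c "{a, b}" p] abc True p dist by auto
    then obtain q :: "'a \<Rightarrow> real^2" where q: "gram_on K {a, b, c} q" "gram_on K {a, d} q"
      using ext[of "p(c := x)"] by auto
    have "degenerate_on (\<lambda>i j. q i \<bullet> q j) {b, c, d}"
      using dist by (intro gram_on_degenerate[OF res]) auto
    then show ?thesis
      using q gram_on_psd[OF res]
      by (intro exI[of _ "\<lambda>i j. q i \<bullet> q j"]) (auto simp: gram_on_def)
  qed
qed

text \<open>The vectors of \<open>c\<close> and \<open>d\<close> are placed independently over
  common vectors of \<open>a\<close> and \<open>b\<close>, and the entry at \<open>c\<close>,
  \<open>d\<close> is whatever results. If both triangles are degenerate, everything fits in one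
  plane.\<close>

lemma psd_glue_triangles:
  fixes K :: "'a::finite \<Rightarrow> 'a \<Rightarrow> real"
  assumes abc: "psd_on K {a, b, c}" and abd: "psd_on K {a, b, d}" and dist: "distinct [a, b, c, d]"
  shows "\<exists>K'. psd_on K' {a, b, c, d} \<and> (\<forall>i\<in>{a, b, c}. \<forall>j\<in>{a, b, c}. K' i j = K i j)
    \<and> (\<forall>i\<in>{a, b, d}. \<forall>j\<in>{a, b, d}. K' i j = K i j)
    \<and> (degenerate_on K {a, b, c} \<and> degenerate_on K {a, b, d} \<longrightarrow> degenerate_on K' {a, c, d})"
proof -
  have res: "gram_on (\<lambda>i j. q i \<bullet> q j) L q" for q :: "'a \<Rightarrow> 'e::euclidean_space" and L
    by (simp add: gram_on_def)
  have ins: "insert c {a, b} = {a, b, c}" "insert d {a, b} = {a, b, d}" by auto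
  have ab: "psd_on K {a, b}" using psd_on_subset[OF abc] by auto
  show ?thesis
  proof (cases "degenerate_on K {a, b, c} \<and> degenerate_on K {a, b, d}")
    case False
    obtain p :: "'a \<Rightarrow> real^4" where p: "gram_on K {a, b, c} p"
      using gram_on_exists[OF abc, where 'e="real^4"] dist by auto
    have "dim (p ` {a, b}) \<le> card (p ` {a, b})" by (rule dim_le_card') simp
    also have "\<dots> \<le> card {a, b}" by (rule card_image_le) simp
    finally have "dim (p ` {a, b}) < DIM(real^4)" using dist by simp
    then obtain x where "gram_on K {a, b, d} (p(d := x))"
      using gram_on_extend[of K d "{a, b}" p] abd dist gram_on_subset[OF p, of "{a, b}"] ins
      by auto
    then show ?thesis
      using False p dist gram_on_psd[OF res]
      by (intro exI[of _ "\<lambda>i j. (p(d := x)) i \<bullet> (p(d := x)) j"]) (auto simp: gram_on_def)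
  next
    case True
    obtain p :: "'a \<Rightarrow> real^2" where p: "gram_on K {a, b} p"
      using gram_on_exists[OF ab, where 'e="real^2"] dist by auto
    obtain x where x: "gram_on K {a, b, c} (p(c := x))"
      using gram_on_extend_degenerate[of K c "{a, b}" p] abc True p dist ins by auto
    obtain y where y: "gram_on K {a, b, d} (p(d := y))"
      using gram_on_extend_degenerate[of K d "{a, b}" p] abd True p dist ins by auto
    define q where "q = p(c := x, d := y)"
    have "degenerate_on (\<lambda>i j. q i \<bullet> q j) {a, c, d}"
      using dist by (intro gram_on_degenerate[OF res]) auto
    then show ?thesis
      using x y dist gram_on_psd[OF res]
      by (intro exI[of _ "\<lambda>i j. q i \<bullet> q j"]) (auto simp: gram_on_def q_def)
  qed
qed

section \<open>Upper bound: completion and realization in four dimensions\<close>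

text \<open>Semidefiniteness is asked only on the three blocks. On the remaining five nodes
  degeneracy suffices, because the segment from \<open>X\<close> restores semidefiniteness
  there.\<close>

lemma V8_relaxed_completion:
  fixes X :: "8 \<Rightarrow> 8 \<Rightarrow> real"
  assumes X: "psd_on X UNIV"
  shows "\<exists>Y. psd_on Y {1, 2, 5, 8} \<and> psd_on Y {3, 2, 7, 4} \<and> psd_on Y {2, 6, 5, 7}
    \<and> (\<forall>i j. Y i j = Y j i) \<and> degenerate_on Y {2, 4, 5, 7, 8}
    \<and> (\<forall>i. Y i i = X i i) \<and> (\<forall>i j. {i, j} \<in> V8 \<longrightarrow> Y i j = X i j)"
proof -
  have psd: "psd_on X L" for L
    by (rule psd_on_subset[OF X]) auto
  obtain y where y: "psd_on (set_entry X 2 5 y) {1, 2, 5}" "psd_on (set_entry X 2 5 y) {2, 6, 5}"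
    "degenerate_on (set_entry X 2 5 y) {1, 2, 5} \<or> degenerate_on (set_entry X 2 5 y) {2, 6, 5}"
    using stretch_entry[of X "{1, 2, 5}" "{2, 6, 5}" 2 5] psd by auto
  define K1 where "K1 = set_entry X 2 5 y"
  \<comment> \<open>The entry (2, 5) occurs in neither triangle of the second stretch; likewise (2,
    7) occurs in neither triangle of the first, so the two stretches do not interfere.\<close>
  have "psd_on K1 {3, 2, 7} \<longleftrightarrow> psd_on X {3, 2, 7}" "psd_on K1 {2, 6, 7} \<longleftrightarrow> psd_on X {2, 6, 7}"
    by (rule psd_on_cong; auto simp: K1_def set_entry_def)+
  then obtain z where z: "psd_on (set_entry K1 2 7 z) {3, 2, 7}"
    "psd_on (set_entry K1 2 7 z) {2, 6, 7}"
    "degenerate_on (set_entry K1 2 7 z) {3, 2, 7} \<or> degenerate_on (set_entry K1 2 7 z) {2, 6, 7}"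
    using stretch_entry[of K1 "{3, 2, 7}" "{2, 6, 7}" 2 7] psd by auto
  define K where "K = set_entry K1 2 7 z"
  have "psd_on K {1, 2, 5} \<longleftrightarrow> psd_on K1 {1, 2, 5}" "psd_on K {2, 6, 5} \<longleftrightarrow> psd_on K1 {2, 6, 5}"
    "psd_on K {1, 8} \<longleftrightarrow> psd_on X {1, 8}" "psd_on K {3, 4} \<longleftrightarrow> psd_on X {3, 4}"
    by (rule psd_on_cong; auto simp: K_def K1_def set_entry_def)+
  then have K: "psd_on K {1, 2, 5}" "psd_on K {2, 6, 5}" "psd_on K {1, 8}" "psd_on K {3, 4}"
    using y psd by (auto simp: K1_def)
  have "degenerate_on K {1, 2, 5} \<longleftrightarrow> degenerate_on K1 {1, 2, 5}"
    "degenerate_on K {2, 6, 5} \<longleftrightarrow> degenerate_on K1 {2, 6, 5}"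
    by (rule degenerate_on_cong; auto simp: K_def K1_def set_entry_def)+
  then have degK: "degenerate_on K {1, 2, 5} \<or> degenerate_on K {2, 6, 5}"
    "degenerate_on K {3, 2, 7} \<or> degenerate_on K {2, 6, 7}"
    using y(3) z(3) by (auto simp: K_def K1_def)
  \<comment> \<open>Node 8 is a leaf at 1, node 4 is a leaf at 3, and the triangles at 6 are glued
    along the edge 26.\<close>
  obtain Y1 where Y1: "psd_on Y1 {1, 2, 5, 8}"
    "\<forall>i\<in>{1, 2, 5}. \<forall>j\<in>{1, 2, 5}. Y1 i j = K i j" "\<forall>i\<in>{1, 8}. \<forall>j\<in>{1, 8}. Y1 i j = K i j"
    "degenerate_on K {1, 2, 5} \<Longrightarrow> degenerate_on Y1 {2, 5, 8}"
    using psd_add_leaf[of K 1 2 5 8] K by auto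
  obtain Y3 where Y3: "psd_on Y3 {3, 2, 7, 4}"
    "\<forall>i\<in>{3, 2, 7}. \<forall>j\<in>{3, 2, 7}. Y3 i j = K i j" "\<forall>i\<in>{3, 4}. \<forall>j\<in>{3, 4}. Y3 i j = K i j"
    "degenerate_on K {3, 2, 7} \<Longrightarrow> degenerate_on Y3 {2, 7, 4}"
    using psd_add_leaf[of K 3 2 7 4] K z(1) by (auto simp: K_def)
  obtain Y6 where Y6: "psd_on Y6 {2, 6, 5, 7}"
    "\<forall>i\<in>{2, 6, 5}. \<forall>j\<in>{2, 6, 5}. Y6 i j = K i j" "\<forall>i\<in>{2, 6, 7}. \<forall>j\<in>{2, 6, 7}. Y6 i j = K i j"
    "degenerate_on K {2, 6, 5} \<and> degenerate_on K {2, 6, 7} \<Longrightarrow> degenerate_on Y6 {2, 5, 7}"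
    using psd_glue_triangles[of K 2 6 5 7] K z(2) by (auto simp: K_def)
  \<comment> \<open>The blocks overlap only in {2}, {2, 5} and {2, 7}, where all three completions
    agree with \<open>K\<close>; the order of the cases is therefore immaterial.\<close>
  define Y where "Y = (\<lambda>i j. if i \<in> {1, 2, 5, 8} \<and> j \<in> {1, 2, 5, 8} then Y1 i j
    else if i \<in> {3, 2, 7, 4} \<and> j \<in> {3, 2, 7, 4} then Y3 i j
    else if i \<in> {2, 6, 5, 7} \<and> j \<in> {2, 6, 5, 7} then Y6 i j else X i j)"
  have YY1: "Y i j = Y1 i j" if "i \<in> {1, 2, 5, 8}" "j \<in> {1, 2, 5, 8}" for i j
    using that by (simp add: Y_def)
  have YY3: "Y i j = Y3 i j" if "i \<in> {3, 2, 7, 4}" "j \<in> {3, 2, 7, 4}" for i j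
  proof -
    have "Y1 2 2 = Y3 2 2" using Y1(2) Y3(2) by simp
    then show ?thesis using that by (auto simp: Y_def)
  qed
  have YY6: "Y i j = Y6 i j" if "i \<in> {2, 6, 5, 7}" "j \<in> {2, 6, 5, 7}" for i j
  proof -
    have "Y1 2 2 = Y6 2 2" "Y1 2 5 = Y6 2 5" "Y1 5 2 = Y6 5 2" "Y1 5 5 = Y6 5 5"
      "Y3 2 7 = Y6 2 7" "Y3 7 2 = Y6 7 2" "Y3 7 7 = Y6 7 7"
      using Y1(2) Y3(2) Y6(2,3) by simp_all
    then show ?thesis using that by (auto simp: Y_def)
  qed
  have KX: "K i j = X i j" if "i = j \<or> {i, j} \<in> V8" for i j
    using that by (auto simp: K_def K1_def set_entry_def V8_def doubleton_eq_iff)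
  have YK125: "Y i j = K i j" if "i \<in> {1, 2, 5}" "j \<in> {1, 2, 5}" for i j
  proof -
    have "Y i j = Y1 i j" by (rule YY1) (use that in auto)
    also have "\<dots> = K i j" using Y1(2) that by blast
    finally show ?thesis .
  qed
  have YK18: "Y i j = K i j" if "i \<in> {1, 8}" "j \<in> {1, 8}" for i j
  proof -
    have "Y i j = Y1 i j" by (rule YY1) (use that in auto)
    also have "\<dots> = K i j" using Y1(3) that by blast
    finally show ?thesis .
  qed
  have YK327: "Y i j = K i j" if "i \<in> {3, 2, 7}" "j \<in> {3, 2, 7}" for i j
  proof -
    have "Y i j = Y3 i j" by (rule YY3) (use that in auto)
    also have "\<dots> = K i j" using Y3(2) that by blast
    finally show ?thesis .
  qed
  have YK34: "Y i j = K i j" if "i \<in> {3, 4}" "j \<in> {3, 4}" for i j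
  proof -
    have "Y i j = Y3 i j" by (rule YY3) (use that in auto)
    also have "\<dots> = K i j" using Y3(3) that by blast
    finally show ?thesis .
  qed
  have YK265: "Y i j = K i j" if "i \<in> {2, 6, 5}" "j \<in> {2, 6, 5}" for i j
  proof -
    have "Y i j = Y6 i j" by (rule YY6) (use that in auto)
    also have "\<dots> = K i j" using Y6(2) that by blast
    finally show ?thesis .
  qed
  have YK267: "Y i j = K i j" if "i \<in> {2, 6, 7}" "j \<in> {2, 6, 7}" for i j
  proof -
    have "Y i j = Y6 i j" by (rule YY6) (use that in auto)
    also have "\<dots> = K i j" using Y6(3) that by blast
    finally show ?thesis .
  qed
  have YX: "Y i j = X i j" if ij: "i = j \<or> {i, j} \<in> V8" for i j
  proof -
    \<comment> \<open>Nine edges meet 1, 3 or 6 and lie in a prescribed part of a block; 45, 78 and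
      48 lie in no block and keep their entries from \<open>X\<close>.\<close>
    have "i \<in> {1, 2, 5} \<and> j \<in> {1, 2, 5} \<or> i \<in> {1, 8} \<and> j \<in> {1, 8}
        \<or> i \<in> {3, 2, 7} \<and> j \<in> {3, 2, 7} \<or> i \<in> {3, 4} \<and> j \<in> {3, 4}
        \<or> i \<in> {2, 6, 5} \<and> j \<in> {2, 6, 5} \<or> i \<in> {2, 6, 7} \<and> j \<in> {2, 6, 7}
        \<or> {i, j} \<in> {{4, 5}, {7, 8}, {4, 8}}"
      using ij UNIV_I[of i] unfolding V8_nodes V8_def by (elim disjE) (auto simp: doubleton_eq_iff)
    then consider "Y i j = K i j" | "{i, j} \<in> {{4, 5}, {7, 8}, {4, 8}}"
      using YK125[of i j] YK18[of i j] YK327[of i j] YK34[of i j] YK265[of i j] YK267[of i j]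
      by argo
    then show ?thesis
    proof cases
      case 1
      then show ?thesis using KX[OF ij] by simp
    next
      case 2
      moreover have "Y 4 5 = X 4 5" "Y 5 4 = X 5 4" "Y 7 8 = X 7 8" "Y 8 7 = X 8 7"
        "Y 4 8 = X 4 8" "Y 8 4 = X 8 4"
        unfolding Y_def by simp_all
      ultimately show ?thesis
        unfolding insert_iff doubleton_eq_iff empty_iff by metis
    qed
  qed
  have "psd_on Y {1, 2, 5, 8} \<longleftrightarrow> psd_on Y1 {1, 2, 5, 8}"
    by (rule psd_on_cong[OF YY1])
  moreover have "psd_on Y {3, 2, 7, 4} \<longleftrightarrow> psd_on Y3 {3, 2, 7, 4}"
    by (rule psd_on_cong[OF YY3])
  moreover have "psd_on Y {2, 6, 5, 7} \<longleftrightarrow> psd_on Y6 {2, 6, 5, 7}"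
    by (rule psd_on_cong[OF YY6])
  ultimately have psdY: "psd_on Y {1, 2, 5, 8}" "psd_on Y {3, 2, 7, 4}" "psd_on Y {2, 6, 5, 7}"
    using Y1(1) Y3(1) Y6(1) by auto
  have "Y i j = Y j i" for i j
  proof -
    consider "i \<in> {1, 2, 5, 8} \<and> j \<in> {1, 2, 5, 8}" | "i \<in> {3, 2, 7, 4} \<and> j \<in> {3, 2, 7, 4}"
      | "i \<in> {2, 6, 5, 7} \<and> j \<in> {2, 6, 5, 7}" | "Y i j = X i j" "Y j i = X j i"
      unfolding Y_def by presburger
    then show ?thesis
      using psdY X unfolding psd_on_def by cases (blast, blast, blast, simp)
  qed
  moreover have "degenerate_on Y {2, 4, 5, 7, 8}"
  proof -
    have "degenerate_on Y {2, 5, 8} \<longleftrightarrow> degenerate_on Y1 {2, 5, 8}"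
      by (rule degenerate_on_cong[OF YY1]) auto
    moreover have "degenerate_on Y {2, 7, 4} \<longleftrightarrow> degenerate_on Y3 {2, 7, 4}"
      by (rule degenerate_on_cong[OF YY3]) auto
    moreover have "degenerate_on Y {2, 5, 7} \<longleftrightarrow> degenerate_on Y6 {2, 5, 7}"
      by (rule degenerate_on_cong[OF YY6]) auto
    \<comment> \<open>If neither {1, 2, 5} nor {3, 2, 7} is degenerate, both triangles at 6
      are.\<close>
    ultimately have "degenerate_on Y {2, 5, 8} \<or> degenerate_on Y {2, 7, 4} \<or> degenerate_on Y {2, 5, 7}"
      using degK Y1(4) Y3(4) Y6(4) by blast
    then show ?thesis
      by (elim disjE) (erule degenerate_on_superset, simp, blast)+
  qed
  ultimately show ?thesis using psdY YX by blast
qed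

lemma gram_on_fun_cong:
  assumes "\<And>i. i \<in> I \<Longrightarrow> p i = q i"
  shows "gram_on K I p \<longleftrightarrow> gram_on K I q"
  using assms by (auto simp: gram_on_def)

text \<open>Singularity on \<open>S\<close> lets its five vectors fit in four dimensions. Each of 1,
  3, 6 then sees only three of them, which leaves a spare dimension.\<close>

lemma V8_realization:
  fixes X :: "8 \<Rightarrow> 8 \<Rightarrow> real"
  assumes X: "psd_on X UNIV"
  shows "\<exists>p :: 8 \<Rightarrow> real^4. (\<forall>i. p i \<bullet> p i = X i i) \<and> (\<forall>i j. {i, j} \<in> V8 \<longrightarrow> p i \<bullet> p j = X i j)"
proof -
  define S where "S = {2, 4, 5, 7, 8 :: 8}"
  have psd: "psd_on X L" for L
    by (rule psd_on_subset[OF X]) auto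
  obtain Y where Y: "psd_on Y {1, 2, 5, 8}" "psd_on Y {3, 2, 7, 4}" "psd_on Y {2, 6, 5, 7}"
    and symY: "\<And>i j. Y i j = Y j i" and degY: "degenerate_on Y S"
    and diagY: "\<And>i. Y i i = X i i" and edgeY: "\<And>i j. {i, j} \<in> V8 \<Longrightarrow> Y i j = X i j"
    using V8_relaxed_completion[OF X] unfolding S_def by metis
  obtain t where t: "0 \<le> t" "t \<le> 1" and psdS: "psd_on (\<lambda>i j. (1 - t) * X i j + t * Y i j) S"
    and degS: "degenerate_on (\<lambda>i j. (1 - t) * X i j + t * Y i j) S"
    using psd_segment_hits_degenerate[OF psd degY symY] by blast
  \<comment> \<open>The segment keeps the diagonal, the edge entries and, by convexity,
    semidefiniteness of the blocks.\<close>
  define Z where "Z = (\<lambda>i j. (1 - t) * X i j + t * Y i j)"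
  have psdZ: "psd_on Z {1, 2, 5, 8}" "psd_on Z {3, 2, 7, 4}" "psd_on Z {2, 6, 5, 7}"
    unfolding Z_def using Y psd t by (auto intro!: psd_on_convex)
  have diagZ: "Z i i = X i i" for i by (simp add: Z_def diagY algebra_simps)
  have edgeZ: "Z i j = X i j" if "{i, j} \<in> V8" for i j
    using edgeY[OF that] by (simp add: Z_def algebra_simps)
  have S: "insert 2 {4, 5, 7, 8} = S" by (simp add: S_def)
  have "psd_on Z {4, 5, 7, 8}"
    using psdS unfolding Z_def by (rule psd_on_subset) (auto simp: S_def)
  then obtain p0 :: "8 \<Rightarrow> real^4" where "gram_on Z {4, 5, 7, 8} p0"
    using gram_on_exists[of Z "{4, 5, 7, 8}", where 'e="real^4"] by auto
  then obtain x where "gram_on Z S (p0(2 := x))"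
    using gram_on_extend_degenerate[of Z 2 "{4, 5, 7, 8}" p0] psdS degS
    unfolding S Z_def[symmetric] by auto
  then obtain p :: "8 \<Rightarrow> real^4" where p: "gram_on Z S p" by blast
  have ext: "\<exists>x. gram_on Z (insert j L) (p(j := x))"
    if "psd_on Z (insert j L)" "L \<subseteq> S" "card L = 3" "j \<notin> L" for j L
  proof (rule gram_on_extend[OF that(1,4)])
    show "gram_on Z L p" by (rule gram_on_subset[OF p that(2)])
    have "dim (p ` L) \<le> card (p ` L)" by (rule dim_le_card') simp
    also have "\<dots> \<le> card L" by (rule card_image_le) simp
    finally show "dim (p ` L) < DIM(real^4)" using that by simp
  qed
  obtain x1 where x1: "gram_on Z {1, 2, 5, 8} (p(1 := x1))"
    using ext[of 1 "{2, 5, 8}"] psdZ(1) by (auto simp: S_def)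
  obtain x3 where x3: "gram_on Z {3, 2, 7, 4} (p(3 := x3))"
    using ext[of 3 "{2, 7, 4}"] psdZ(2) by (auto simp: S_def)
  obtain x6 where x6: "gram_on Z {6, 2, 5, 7} (p(6 := x6))"
    using ext[of 6 "{2, 5, 7}"] psdZ(3) by (auto simp: S_def insert_commute)
  \<comment> \<open>No block contains two of 1, 3, 6, so the three extensions can be made at
    once.\<close>
  define q where "q = p(1 := x1, 3 := x3, 6 := x6)"
  have "gram_on Z S q \<longleftrightarrow> gram_on Z S p"
    "gram_on Z {1, 2, 5, 8} q \<longleftrightarrow> gram_on Z {1, 2, 5, 8} (p(1 := x1))"
    "gram_on Z {3, 2, 7, 4} q \<longleftrightarrow> gram_on Z {3, 2, 7, 4} (p(3 := x3))"
    "gram_on Z {6, 2, 5, 7} q \<longleftrightarrow> gram_on Z {6, 2, 5, 7} (p(6 := x6))"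
    by (rule gram_on_fun_cong; auto simp: q_def S_def)+
  then have q: "gram_on Z S q" "gram_on Z {1, 2, 5, 8} q" "gram_on Z {3, 2, 7, 4} q"
    "gram_on Z {6, 2, 5, 7} q"
    using p x1 x3 x6 by simp_all
  have qZ: "q i \<bullet> q j = Z i j"
    if "i \<in> S \<and> j \<in> S \<or> i \<in> {1, 2, 5, 8} \<and> j \<in> {1, 2, 5, 8}
      \<or> i \<in> {3, 2, 7, 4} \<and> j \<in> {3, 2, 7, 4} \<or> i \<in> {6, 2, 5, 7} \<and> j \<in> {6, 2, 5, 7}" for i j
    using that by (elim disjE conjE) (rule q[THEN gram_onD]; assumption)+
  have "q i \<bullet> q i = X i i" for i
    using UNIV_I[of i] unfolding V8_nodes diagZ[symmetric]
    by (intro qZ) (auto simp: S_def)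
  moreover have "q i \<bullet> q j = X i j" if "{i, j} \<in> V8" for i j
    unfolding edgeZ[OF that, symmetric] using that
    by (intro qZ) (auto simp: S_def V8_def doubleton_eq_iff)
  ultimately show ?thesis by blast
qed

section \<open>Passage between index functions and matrices\<close>

lemma psd_iff_psd_on:
  fixes A :: "real^'n^'n"
  shows "psd A \<longleftrightarrow> psd_on (\<lambda>i j. A $ i $ j) UNIV"
proof -
  have "x \<bullet> (A *v x) = qform (\<lambda>i j. A $ i $ j) UNIV (($) x)" for x
    by (simp add: qform_def inner_vec_def matrix_vector_mult_def sum_distrib_left ac_simps)
  moreover have "(\<forall>x :: real^'n. 0 \<le> qform (\<lambda>i j. A $ i $ j) UNIV (($) x))
      \<longleftrightarrow> (\<forall>v. 0 \<le> qform (\<lambda>i j. A $ i $ j) UNIV v)"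
    by (metis vec_lambda_inverse UNIV_I)
  moreover have "transpose A = A \<longleftrightarrow> (\<forall>i j. A $ i $ j = A $ j $ i)"
    by (auto simp: transpose_def vec_eq_iff)
  ultimately show ?thesis by (simp add: psd_def psd_on_def)
qed

lemma psd_gram:
  fixes p :: "'n::finite \<Rightarrow> 'e::euclidean_space"
  shows "psd (\<chi> i j. p i \<bullet> p j)"
  unfolding psd_iff_psd_on by (rule gram_on_psd[of _ _ p]) (simp add: gram_on_def)

text \<open>The Gram matrix factors as \<open>P ** transpose P\<close>, with the vectors as the rows
  of \<open>P\<close>.\<close>

lemma rank_gram_le:
  fixes p :: "'n::finite \<Rightarrow> real^'k"
  shows "rank ((\<chi> i j. p i \<bullet> p j) :: real^'n^'n) \<le> CARD('k)"
proof -
  have "(\<chi> i j. p i \<bullet> p j) = (\<chi> i. p i) ** transpose (\<chi> i. p i)"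
    by (simp add: vec_eq_iff matrix_matrix_mult_def transpose_def inner_vec_def)
  then have "rank (\<chi> i j. p i \<bullet> p j) \<le> rank (transpose (\<chi> i. p i))"
    by (metis rank_mul_le_right)
  also have "\<dots> \<le> CARD('k)" using rank_bound[of "transpose (\<chi> i. p i)"] by simp
  finally show ?thesis .
qed

section \<open>Lower bound: contraction to the complete graph on four nodes\<close>

definition pair_rep :: "8 \<Rightarrow> 8" where
  "pair_rep i = (if i = 2 then 1 else if i = 4 then 3 else if i = 6 then 5 else if i = 8 then 7 else i)"

text \<open>Written as a Gram matrix so that \<open>psd_gram\<close> applies directly.\<close>

definition pair_matrix :: "real^8^8" where
  "pair_matrix = (\<chi> i j. axis (pair_rep i) 1 \<bullet> (axis (pair_rep j) 1 :: real^8))"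

lemma pair_matrix_nth: "pair_matrix $ i $ j = (if pair_rep i = pair_rep j then 1 else 0)"
  by (simp add: pair_matrix_def inner_axis_axis)

text \<open>The rows of the four representatives are nonzero with disjoint supports, hence
  orthogonal and independent.\<close>

lemma rank_pair_matrix: "4 \<le> rank pair_matrix"
proof -
  define B where "B = ($) pair_matrix ` {1, 3, 5, 7}"
  have neq: "pair_matrix $ i \<noteq> pair_matrix $ j" if "pair_rep i \<noteq> pair_rep j" for i j
    using that pair_matrix_nth[of i i] pair_matrix_nth[of j i] by auto
  have orth: "orthogonal (pair_matrix $ i) (pair_matrix $ j)"
    if "pair_matrix $ i \<noteq> pair_matrix $ j" for i j
  proof -
    have "pair_rep i \<noteq> pair_rep j"
      using that by (auto simp: vec_eq_iff pair_matrix_nth)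
    then show ?thesis
      by (auto simp: orthogonal_def inner_vec_def pair_matrix_nth intro!: sum.neutral)
  qed
  have "pairwise orthogonal B"
    unfolding B_def by (rule pairwise_imageI) (rule orth)
  moreover have "pair_matrix $ i \<noteq> 0" for i
    using pair_matrix_nth[of i i] by auto
  then have "0 \<notin> B"
    unfolding B_def by force
  ultimately have "independent B" by (rule pairwise_orthogonal_independent)
  then have "card B \<le> dim (rows pair_matrix)"
    by (intro independent_card_le_dim) (auto simp: B_def rows_def row_def)
  moreover have "card B = 4"
    unfolding B_def using neq[of 1 3] neq[of 1 5] neq[of 1 7] neq[of 3 5] neq[of 3 7] neq[of 5 7]
    by (subst card_image) (auto intro!: inj_onI simp: pair_rep_def)
  ultimately show ?thesis by (simp add: row_rank_def)
qed

text \<open>Unit vectors with inner product 1 coincide, so each contracted edge merges its ends. Any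
  two of the four merged nodes are joined by an edge, which forces their vectors to be
  orthogonal.\<close>

lemma pair_matrix_unique:
  assumes psd: "psd X" and diag: "\<And>i. X $ i $ i = pair_matrix $ i $ i"
    and edge: "\<And>i j. {i, j} \<in> V8 \<Longrightarrow> X $ i $ j = pair_matrix $ i $ j"
  shows "X = pair_matrix"
proof -
  obtain p :: "8 \<Rightarrow> real^8" where "gram_on (\<lambda>i j. X $ i $ j) UNIV p"
    using gram_on_exists[of "\<lambda>i j. X $ i $ j" UNIV, where 'e="real^8"] psd
    by (auto simp: psd_iff_psd_on)
  then have p: "X $ i $ j = p i \<bullet> p j" for i j by (simp add: gram_on_def)
  have e: "p i \<bullet> p j = (if pair_rep i = pair_rep j then 1 else 0)" if "i = j \<or> {i, j} \<in> V8" for i j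
    using that diag edge[of i j] unfolding p pair_matrix_nth by auto
  have merge: "p i = p j" if "{i, j} \<in> V8" "pair_rep i = pair_rep j" for i j
  proof -
    have "(p i - p j) \<bullet> (p i - p j) = 0"
      using e[of i i] e[of j j] e[of i j] that
      by (simp add: inner_diff_left inner_diff_right inner_commute)
    then show ?thesis by simp
  qed
  have "p 2 = p 1" "p 4 = p 3" "p 6 = p 5" "p 8 = p 7"
    by (rule merge; simp add: V8_def pair_rep_def doubleton_eq_iff)+
  then have rep: "p i = p (pair_rep i)" for i by (simp add: pair_rep_def)
  \<comment> \<open>One edge of \<open>V8\<close> for each of the six pairs of merged nodes.\<close>
  have "p 2 \<bullet> p 3 = 0" "p 1 \<bullet> p 5 = 0" "p 8 \<bullet> p 1 = 0"
    "p 4 \<bullet> p 5 = 0" "p 3 \<bullet> p 7 = 0" "p 6 \<bullet> p 7 = 0"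
    by (subst e; simp add: V8_def pair_rep_def doubleton_eq_iff)+
  then have orth: "p 1 \<bullet> p 3 = 0" "p 1 \<bullet> p 5 = 0" "p 1 \<bullet> p 7 = 0"
    "p 3 \<bullet> p 5 = 0" "p 3 \<bullet> p 7 = 0" "p 5 \<bullet> p 7 = 0"
    using \<open>p 2 = p 1\<close> \<open>p 4 = p 3\<close> \<open>p 6 = p 5\<close> \<open>p 8 = p 7\<close> by (simp_all add: inner_commute)
  have "p a \<bullet> p a = 1" for a using e[of a a] by simp
  with orth have "p a \<bullet> p b = (if a = b then 1 else 0)"
    if "a \<in> {1, 3, 5, 7}" "b \<in> {1, 3, 5, 7}" for a b
    using that orth[unfolded inner_commute[of "p 1"] inner_commute[of "p 3" "p 5"]
        inner_commute[of "p 3" "p 7"] inner_commute[of "p 5" "p 7"]]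
    by auto
  moreover have "pair_rep i \<in> {1, 3, 5, 7}" for i
    using UNIV_I[of i] unfolding V8_nodes by (auto simp: pair_rep_def)
  ultimately have "X $ i $ j = pair_matrix $ i $ j" for i j
    unfolding p pair_matrix_nth by (metis rep)
  then show ?thesis by (simp add: vec_eq_iff)
qed

theorem theorem10: "gram_dim V8 = 4"
  unfolding gram_dim_def
proof (rule Least_equality, intro conjI allI impI)
  fix X :: "real^8^8"
  assume "psd X"
  then obtain p :: "8 \<Rightarrow> real^4" where p: "\<And>i. p i \<bullet> p i = X $ i $ i"
    "\<And>i j. {i, j} \<in> V8 \<Longrightarrow> p i \<bullet> p j = X $ i $ j"
    using V8_realization[of "\<lambda>i j. X $ i $ j"] by (auto simp: psd_iff_psd_on)
  show "\<exists>X' :: real^8^8. psd X' \<and> rank X' \<le> 4 \<and> (\<forall>i. X' $ i $ i = X $ i $ i)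
      \<and> (\<forall>i j. {i, j} \<in> V8 \<longrightarrow> X' $ i $ j = X $ i $ j)"
    using rank_gram_le[of p] p
    by (intro exI[of _ "\<chi> i j. p i \<bullet> p j"]) (simp add: psd_gram)
next
  fix k
  assume k: "1 \<le> k \<and> (\<forall>X :: real^8^8. psd X \<longrightarrow> (\<exists>X' :: real^8^8. psd X' \<and> rank X' \<le> k
      \<and> (\<forall>i. X' $ i $ i = X $ i $ i) \<and> (\<forall>i j. {i, j} \<in> V8 \<longrightarrow> X' $ i $ j = X $ i $ j)))"
  have "psd pair_matrix" unfolding pair_matrix_def by (rule psd_gram)
  then obtain X' :: "real^8^8" where "psd X'" "rank X' \<le> k"
    "\<And>i. X' $ i $ i = pair_matrix $ i $ i"
    "\<And>i j. {i, j} \<in> V8 \<Longrightarrow> X' $ i $ j = pair_matrix $ i $ j"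
    using k by metis
  then show "4 \<le> k"
    \<comment> \<open>Uniqueness identifies \<open>X'\<close> with \<open>pair_matrix\<close>, so
      \<open>k\<close> bounds a rank that is at least 4.\<close>
    using pair_matrix_unique[of X'] rank_pair_matrix by simp
qed simp

end
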